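(* Let $\mathcal{X}\subset S^d$ be a nonempty closed spherical convex set and $\widehat{\mathcal{X}}=\mathcal{X}\cup-\mathcal{X}$. Then $(\mathcal{X}^\circ,-\mathcal{X}^\circ)$ is the largest pair separated by $\widehat{\mathcal{X}}$; that is, $\mathcal{X}=\mathcal{C}(\mathcal{X}^\circ,-\mathcal{X}^\circ)$ (so $\widehat{\mathcal{X}}$ is the separation center set of $\mathcal{X}^\circ,-\mathcal{X}^\circ$), and for any nonempty closed spherical convex sets $W_1,W_2\subset S^d$ with $\mathcal{X}=\mathcal{C}(W_1,W_2)$ one has $W_1\subset\mathcal{X}^\circ$ and $W_2\subset-\mathcal{X}^\circ$.
   Context: $S^d$ is the unit sphere of $\mathbb{R}^{d+1}$ with scalar product $P\cdot Q$, and $H(P)=\{Q\in S^d\mid P\cdot Q\geq0\}$. A set $W\subset S^d$ is hemispherical if $W\cap H(P)=\emptyset$ for some $P\in S^d$; a hemispherical set $W$ is spherical convex if $\frac{tP+(1-t)Q}{\|tP+(1-t)Q\|}\in W$ for all $P,Q\in W$, $t\in[0,1]$. The spherical polar set of $W\subset S^d$ is $W^\circ=\bigcap_{P\in W}H(P)$. For $W_1,W_2\subset S^d$, $$\mathcal{C}(W_1,W_2)=\{P\in S^d\mid P\cdot Q\ge0\ \text{for any }Q\in W_1\ \text{and}\ P\cdot R\le0\ \text{for any }R\in W_2\},$$ and $\mathcal{C}(W_1,W_2)\cup\mathcal{C}(W_2,W_1)$ is the separation center set of $W_1,W_2$. *)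

theory Defs
  imports "HOL-Analysis.Analysis"
begin

text \<open>The space \<open>'a :: euclidean_space\<close> plays the role of \<open>\<real>\<^bsup>d+1\<^esup>\<close> with \<open>DIM('a) = d + 1\<close>, and
  the inner product \<open>\<bullet>\<close> is the scalar product. For subsets of the closed set \<open>sphere 0 1\<close>, being
  closed in the sphere and being closed in the ambient space coincide, so \<open>closed\<close> is used.\<close>

abbreviation usphere :: "'a::euclidean_space set" where
  "usphere \<equiv> sphere 0 1"

definition hemisphere :: "'a::euclidean_space \<Rightarrow> 'a set" where
  "hemisphere P = {Q \<in> usphere. P \<bullet> Q \<ge> 0}"

definition hemispherical :: "'a::euclidean_space set \<Rightarrow> bool" where
  "hemispherical W \<longleftrightarrow> W \<subseteq> usphere \<and> (\<exists>P\<in>usphere. W \<inter> hemisphere P = {})"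

text \<open>The denominator below is nonzero: a hemispherical set lies in an open half space
  bounded by a hyperplane through the origin.\<close>

definition spherical_convex :: "'a::euclidean_space set \<Rightarrow> bool" where
  "spherical_convex W \<longleftrightarrow> hemispherical W \<and>
     (\<forall>P\<in>W. \<forall>Q\<in>W. \<forall>t\<in>{0..1::real}.
        (t *\<^sub>R P + (1 - t) *\<^sub>R Q) /\<^sub>R norm (t *\<^sub>R P + (1 - t) *\<^sub>R Q) \<in> W)"

text \<open>Intersecting with the sphere only matters for empty \<open>W\<close>: an empty intersection of subsets of
  the sphere is the whole sphere, not \<open>UNIV\<close>.\<close>

definition spherical_polar :: "'a::euclidean_space set \<Rightarrow> 'a set" where
  "spherical_polar W = usphere \<inter> (\<Inter>P\<in>W. hemisphere P)"

definition sep_center :: "'a::euclidean_space set \<Rightarrow> 'a set \<Rightarrow> 'a set" where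
  "sep_center W1 W2 = {P \<in> usphere. (\<forall>Q\<in>W1. P \<bullet> Q \<ge> 0) \<and> (\<forall>R\<in>W2. P \<bullet> R \<le> 0)}"

definition separation_center_set :: "'a::euclidean_space set \<Rightarrow> 'a set \<Rightarrow> 'a set" where
  "separation_center_set W1 W2 = sep_center W1 W2 \<union> sep_center W2 W1"

text \<open>The antipodal set; the notation \<open>- W\<close> would denote the complement.\<close>

abbreviation antipodal :: "'a::euclidean_space set \<Rightarrow> 'a set" where
  "antipodal W \<equiv> uminus ` W"

end

theory Submission
  imports Defs
begin

text \<open>Everything rests on the bipolar identity for closed spherical convex sets. The conic hull of
  such a set is a closed convex cone, so a point of the sphere outside it is strictly separated from
  it by a hyperplane, which can be taken through the origin; its unit normal is a point of the polar
  set having negative product with the given point.\<close>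

lemma spherical_polar_iff:
  "Q \<in> spherical_polar W \<longleftrightarrow> norm Q = 1 \<and> (\<forall>P\<in>W. P \<bullet> Q \<ge> 0)"
  by (auto simp: spherical_polar_def hemisphere_def)

lemma mem_antipodal_iff: "P \<in> antipodal W \<longleftrightarrow> - P \<in> W"
  by force

lemma sep_center_commute: "sep_center W2 W1 = antipodal (sep_center W1 W2)"
  by (auto simp: sep_center_def mem_antipodal_iff)

text \<open>The condition on the antipodal points is the first condition with its sign reversed
  twice, so only the polar condition remains. This turns the claim about \<open>X\<close> into the
  bipolar identity.\<close>

lemma sep_center_antipodal:
  "sep_center W (antipodal W) = spherical_polar W"
  by (auto simp: sep_center_def spherical_polar_iff inner_commute)

text \<open>Up to a positive factor, a sum of nonnegative multiples of two points of
  \<open>X\<close> is a convex combination of them, and spherical convexity puts the normalised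
  combination back into \<open>X\<close>.\<close>

lemma convex_cone_conic_hull_spherical_convex:
  fixes X :: "'a::euclidean_space set"
  assumes "X \<noteq> {}" and "spherical_convex X"
  shows "convex_cone (conic hull X)"
proof -
  have zero: "0 \<in> conic hull X"
    using assms(1) by (simp add: conic_hull_contains_0)
  have add: "u + v \<in> conic hull X" if uv: "u \<in> conic hull X" "v \<in> conic hull X" for u v
  proof -
    obtain a x b y where a: "a \<ge> 0" "x \<in> X" "u = a *\<^sub>R x" and b: "b \<ge> 0" "y \<in> X" "v = b *\<^sub>R y"
      using uv by (auto simp: conic_hull_explicit)
    show ?thesis
    proof (cases "u + v = 0")
      case True
      then show ?thesis using zero by simp
    next
      case False
      define t where "t = a / (a + b)"
      \<comment> \<open>Nonnegative \<open>a\<close> and \<open>b\<close> with sum zero would both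
        vanish, giving \<open>u + v = 0\<close>.\<close>
      have pos: "a + b > 0"
        using False a b by (cases "a + b = 0") (auto simp: add_nonneg_eq_0_iff)
      have "t \<in> {0..1}"
        using a b pos by (simp add: t_def)
      have "1 - t = b / (a + b)"
        using pos by (simp add: t_def field_simps)
      let ?w = "t *\<^sub>R x + (1 - t) *\<^sub>R y"
      have "u + v = (a + b) *\<^sub>R ?w"
        using pos a(3) b(3) \<open>1 - t = b / (a + b)\<close> by (simp add: t_def scaleR_add_right)
      moreover have "?w /\<^sub>R norm ?w \<in> X"
        using assms(2) a b \<open>t \<in> {0..1}\<close> by (simp add: spherical_convex_def)
      moreover have "?w \<noteq> 0"
        using False calculation(1) by auto
      ultimately have "u + v = ((a + b) * norm ?w) *\<^sub>R (?w /\<^sub>R norm ?w)"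
        by simp
      then show ?thesis
        unfolding conic_hull_explicit
        using \<open>?w /\<^sub>R norm ?w \<in> X\<close> pos by (smt (verit) mem_Collect_eq mult_nonneg_nonneg norm_ge_zero)
    qed
  qed
  show ?thesis
    using zero add by (auto simp: convex_cone_iff intro: conicD conic_conic_hull)
qed

text \<open>A linear functional bounded below on a cone cannot be negative anywhere on it, since
  scaling would violate the bound. The separating hyperplane can therefore be moved to the
  origin.\<close>

lemma separating_hyperplane_closed_convex_cone:
  fixes K :: "'a::euclidean_space set"
  assumes "convex_cone K" and "closed K" and "z \<notin> K"
  obtains a where "a \<bullet> z < 0" and "\<And>x. x \<in> K \<Longrightarrow> a \<bullet> x \<ge> 0"
proof -
  obtain a b where ab: "a \<bullet> z < b" "\<And>x. x \<in> K \<Longrightarrow> a \<bullet> x > b"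
    using separating_hyperplane_closed_point[of K z] assms by (auto simp: convex_cone_def)
  have "b < 0"
    using ab(2) convex_cone_contains_0[OF assms(1)] by fastforce
  have "a \<bullet> x \<ge> 0" if "x \<in> K" for x
  proof (rule ccontr)
    assume "\<not> a \<bullet> x \<ge> 0"
    \<comment> \<open>The factor is a quotient of two negative numbers, chosen so that the scaled
      point has product exactly \<open>b\<close> with \<open>a\<close>, against the strict
      bound.\<close>
    then have "(b / (a \<bullet> x)) *\<^sub>R x \<in> K"
      using that \<open>b < 0\<close> by (intro convex_cone_scaleR[OF assms(1)]) (auto simp: divide_nonpos_nonpos)
    from ab(2)[OF this] \<open>\<not> a \<bullet> x \<ge> 0\<close> show False by simp
  qed
  moreover have "a \<bullet> z < 0"
    using ab(1) \<open>b < 0\<close> by linarith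
  ultimately show thesis
    by (intro that)
qed

lemma spherical_bipolar:
  fixes X :: "'a::euclidean_space set"
  assumes "X \<noteq> {}" and "closed X" and "spherical_convex X"
  shows "spherical_polar (spherical_polar X) = X"
proof
  have sphere: "norm P = 1" if "P \<in> X" for P
    using assms(3) that by (auto simp: spherical_convex_def hemispherical_def)
  then show "X \<subseteq> spherical_polar (spherical_polar X)"
    by (auto simp: spherical_polar_iff) (metis inner_commute)
  show "spherical_polar (spherical_polar X) \<subseteq> X"
  proof
    fix P assume P: "P \<in> spherical_polar (spherical_polar X)"
    have "bounded X"
      using sphere by (auto simp: bounded_iff)
    \<comment> \<open>Compactness alone would not suffice: a disc with 0 on its boundary generates a
      cone that is not closed. Here 0 is excluded because \<open>X\<close> consists of unit
      vectors.\<close>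
    then have "closed (conic hull X)"
      using assms(2) sphere by (intro closed_conic_hull) (force simp: compact_eq_bounded_closed)
    have "P \<in> conic hull X"
    proof (rule ccontr)
      assume "P \<notin> conic hull X"
      then obtain a where a: "a \<bullet> P < 0" "\<And>x. x \<in> conic hull X \<Longrightarrow> a \<bullet> x \<ge> 0"
        using separating_hyperplane_closed_convex_cone convex_cone_conic_hull_spherical_convex
          assms \<open>closed (conic hull X)\<close> by metis
      have "a \<noteq> 0"
        using a(1) by auto
      have "a /\<^sub>R norm a \<in> spherical_polar X"
        using \<open>a \<noteq> 0\<close> a(2) by (auto simp: spherical_polar_iff inner_commute hull_inc)
      with P have "(a /\<^sub>R norm a) \<bullet> P \<ge> 0"
        unfolding spherical_polar_iff[of P] by blast
      with a(1) \<open>a \<noteq> 0\<close> show False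
        by (simp add: zero_le_mult_iff)
    qed
    then obtain c x where "c \<ge> 0" "x \<in> X" "P = c *\<^sub>R x"
      by (auto simp: conic_hull_explicit)
    \<comment> \<open>Both \<open>P\<close> and \<open>x\<close> are unit vectors and
      \<open>c\<close> is nonnegative, so \<open>c = 1\<close>.\<close>
    then show "P \<in> X"
      using P sphere[of x] by (simp add: spherical_polar_iff)
  qed
qed

theorem corollary3:
  fixes X :: "'a::euclidean_space set"
  assumes "X \<subseteq> usphere" and "X \<noteq> {}" and "closed X" and "spherical_convex X"
  shows "X = sep_center (spherical_polar X) (antipodal (spherical_polar X))
    \<and> X \<union> antipodal X = separation_center_set (spherical_polar X) (antipodal (spherical_polar X))
    \<and> (\<forall>W1 W2. W1 \<subseteq> usphere \<and> W1 \<noteq> {} \<and> closed W1 \<and> spherical_convex W1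
          \<and> W2 \<subseteq> usphere \<and> W2 \<noteq> {} \<and> closed W2 \<and> spherical_convex W2
          \<and> X = sep_center W1 W2
        \<longrightarrow> W1 \<subseteq> spherical_polar X \<and> W2 \<subseteq> antipodal (spherical_polar X))"
proof (intro conjI allI impI)
  show X: "X = sep_center (spherical_polar X) (antipodal (spherical_polar X))"
    using assms by (simp add: sep_center_antipodal spherical_bipolar)
  \<comment> \<open>Exchanging the two sets negates the center, so the second half of the separation
    center set is \<open>antipodal X\<close>.\<close>
  then show "X \<union> antipodal X
      = separation_center_set (spherical_polar X) (antipodal (spherical_polar X))"
    unfolding separation_center_set_def
    using sep_center_commute[of "antipodal (spherical_polar X)" "spherical_polar X"] by simp
next
  fix W1 W2 :: "'a set"
  assume *: "W1 \<subseteq> usphere \<and> W1 \<noteq> {} \<and> closed W1 \<and> spherical_convex W1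
          \<and> W2 \<subseteq> usphere \<and> W2 \<noteq> {} \<and> closed W2 \<and> spherical_convex W2
          \<and> X = sep_center W1 W2"
  \<comment> \<open>The inequalities that define \<open>X\<close> from \<open>W1\<close> and
    \<open>W2\<close> are symmetric in the two factors of the product. Fixing a point of
    \<open>W1\<close>, or the negative of a point of \<open>W2\<close>, and varying the point of
    \<open>X\<close> gives membership in the polar set.\<close>
  then show "W1 \<subseteq> spherical_polar X"
    by (auto simp: spherical_polar_iff sep_center_def)
  from * show "W2 \<subseteq> antipodal (spherical_polar X)"
    by (auto simp: spherical_polar_iff sep_center_def mem_antipodal_iff simp del: image_iff)
qed

end
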